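(* Let $u,b,k\ge 1$ and $w\ge 0$ be integers with $bk=2u+w$, put $v=u+w$, and let $d_0$ be a connected full design with parameters $(u,b,k)$ (i.e. $b$ blocks of size $k$, $u$ treatments replicated twice each, $w$ treatments replicated once each). Then the variances of the best linear unbiased estimators (BLUEs) of all the $v(v-1)/2$ pairwise treatment contrasts (differences of two treatment effects) in $d_0$ sum to $\sigma^2 A(d_0)$, where $$A(d_0)=\tfrac12 w(3u+2w-b-1)+u\,\mathrm{tr}(C^+)+\tfrac12 k\{w\,\mathrm{tr}(\tilde C^+)+b\,\mathrm{tr}(\tilde C^+S)\}.$$
   Context: A full design $d_0$ with parameters $(u,b,k)$ is a block design with $b$ blocks, each consisting of $k$ plots, each plot receiving one treatment, with $v=u+w$ treatments ($w=bk-2u$): a set $U$ of $u$ treatments, each occurring on exactly two plots, and a set $W$ of $w$ treatments, each occurring on exactly one plot. A treatment may occur twice in the same block (binarity is not assumed). Model: the observation from a plot in block $j$ receiving treatment $t$ has expectation (fixed effect of $t$) + (fixed effect of block $j$); observations are uncorrelated with common variance $\sigma^2$. $d_0$ is connected if every difference of two treatment effects is estimable (has a linear unbiased estimator). For $j=1,\dots,b$, $s_j$ is the number of plots of block $j$ occupied by treatments in $W$; so $w=s_1+\dots+s_b$, and connectedness forces $0\le s_j\le k-1$. Put $S=\mathrm{diag}(s_1,\dots,s_b)$. The subdesign $d$ consists of the plots of $d_0$ receiving treatments in $U$ (block sizes $k-s_j$); $N=(n_{ij})$ is its $u\times b$ incidence matrix, $n_{ij}$ being the number of times treatment $i\in U$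 occurs in block $j$. Define $$C=2I_u-N(kI_b-S)^{-1}N^T,\qquad \tilde C=kI_b-S-\tfrac12N^TN,$$ the intrablock information matrices of $d$ and of its dual. $C^+$, $\tilde C^+$ are Moore–Penrose inverses. *)

theory Defs
  imports
    "HOL-Probability.Probability"
    "Jordan_Normal_Form.Matrix"
    "Jordan_Normal_Form.Gauss_Jordan_Elimination"
begin

section \<open>Designs\<close>

text \<open>
  Blocks are numbered \<open>0, \<dots>, b - 1\<close>, and plot \<open>l < k\<close> of block \<open>j < b\<close> is the pair \<open>(j, l)\<close>.
  A design is an assignment \<open>d\<close> of treatments to plots. The treatments are numbered so that
  \<open>U = {0..<u}\<close> and \<open>W = {u..<u + w}\<close>. Nothing prevents a treatment from occurring
  twice in one block.
\<close>

type_synonym plot = "nat \<times> nat"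

definition plots :: "nat \<Rightarrow> nat \<Rightarrow> plot set" where
  "plots b k = {..<b} \<times> {..<k}"

definition full_design :: "nat \<Rightarrow> nat \<Rightarrow> nat \<Rightarrow> nat \<Rightarrow> (plot \<Rightarrow> nat) \<Rightarrow> bool" where
  "full_design u w b k d \<longleftrightarrow>
     b * k = 2 * u + w \<and>
     (\<forall>p\<in>plots b k. d p < u + w) \<and>
     (\<forall>t\<in>{0..<u}. card {p \<in> plots b k. d p = t} = 2) \<and>
     (\<forall>t\<in>{u..<u + w}. card {p \<in> plots b k. d p = t} = 1)"


section \<open>The linear model\<close>

text \<open>
  The model is a family \<open>P \<tau> \<beta>\<close> of probability measures indexed by the unknown treatment effects
  \<open>\<tau>\<close> and block effects \<open>\<beta>\<close>; \<open>Y p\<close> is the observation from plot \<open>p\<close>. The last clause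
  says that the observations are uncorrelated with common variance \<open>\<sigma>\<^sup>2\<close>. The integrability
  of the squares is needed since Bochner integrals of non-integrable functions are zero.
\<close>

type_synonym 'o model = "(nat \<Rightarrow> real) \<Rightarrow> (nat \<Rightarrow> real) \<Rightarrow> 'o measure"

definition block_model ::
  "nat \<Rightarrow> nat \<Rightarrow> (plot \<Rightarrow> nat) \<Rightarrow> real \<Rightarrow> 'o model \<Rightarrow> (plot \<Rightarrow> 'o \<Rightarrow> real) \<Rightarrow> bool" where
  "block_model b k d \<sigma> P Y \<longleftrightarrow> (\<forall>\<tau> \<beta>.
     prob_space (P \<tau> \<beta>) \<and>
     (\<forall>p\<in>plots b k.
        Y p \<in> borel_measurable (P \<tau> \<beta>) \<and>
        integrable (P \<tau> \<beta>) (\<lambda>\<omega>. (Y p \<omega>)\<^sup>2) \<and>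
        prob_space.expectation (P \<tau> \<beta>) (Y p) = \<tau> (d p) + \<beta> (fst p)) \<and>
     (\<forall>p\<in>plots b k. \<forall>q\<in>plots b k.
        prob_space.expectation (P \<tau> \<beta>)
          (\<lambda>\<omega>. (Y p \<omega> - prob_space.expectation (P \<tau> \<beta>) (Y p)) *
               (Y q \<omega> - prob_space.expectation (P \<tau> \<beta>) (Y q)))
        = (if p = q then \<sigma>\<^sup>2 else 0)))"

definition linear_estimator ::
  "nat \<Rightarrow> nat \<Rightarrow> (plot \<Rightarrow> 'o \<Rightarrow> real) \<Rightarrow> ('o \<Rightarrow> real) \<Rightarrow> bool" where
  "linear_estimator b k Y T \<longleftrightarrow> (\<exists>c. T = (\<lambda>\<omega>. \<Sum>p\<in>plots b k. c p * Y p \<omega>))"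

text \<open>Linear unbiased estimators of the treatment contrast \<open>\<tau> i - \<tau> j\<close>.\<close>

definition lue ::
  "nat \<Rightarrow> nat \<Rightarrow> 'o model \<Rightarrow> (plot \<Rightarrow> 'o \<Rightarrow> real) \<Rightarrow> nat \<Rightarrow> nat \<Rightarrow> ('o \<Rightarrow> real) \<Rightarrow> bool" where
  "lue b k P Y i j T \<longleftrightarrow>
     linear_estimator b k Y T \<and>
     (\<forall>\<tau> \<beta>. prob_space.expectation (P \<tau> \<beta>) T = \<tau> i - \<tau> j)"

definition blue ::
  "nat \<Rightarrow> nat \<Rightarrow> 'o model \<Rightarrow> (plot \<Rightarrow> 'o \<Rightarrow> real) \<Rightarrow> nat \<Rightarrow> nat \<Rightarrow> ('o \<Rightarrow> real) \<Rightarrow> bool" where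
  "blue b k P Y i j T \<longleftrightarrow>
     lue b k P Y i j T \<and>
     (\<forall>T'. lue b k P Y i j T' \<longrightarrow>
        (\<forall>\<tau> \<beta>. prob_space.variance (P \<tau> \<beta>) T \<le> prob_space.variance (P \<tau> \<beta>) T'))"

definition connected_design ::
  "nat \<Rightarrow> nat \<Rightarrow> nat \<Rightarrow> 'o model \<Rightarrow> (plot \<Rightarrow> 'o \<Rightarrow> real) \<Rightarrow> bool" where
  "connected_design v b k P Y \<longleftrightarrow> (\<forall>i<v. \<forall>j<v. \<exists>T. lue b k P Y i j T)"


section \<open>Information matrices\<close>

definition W_plots :: "nat \<Rightarrow> nat \<Rightarrow> (plot \<Rightarrow> nat) \<Rightarrow> nat \<Rightarrow> nat" where
  "W_plots u k d j = card {l. l < k \<and> u \<le> d (j, l)}"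

definition S_mat :: "nat \<Rightarrow> nat \<Rightarrow> nat \<Rightarrow> (plot \<Rightarrow> nat) \<Rightarrow> real mat" where
  "S_mat u b k d = mat_diag b (\<lambda>j. real (W_plots u k d j))"

definition N_mat :: "nat \<Rightarrow> nat \<Rightarrow> nat \<Rightarrow> (plot \<Rightarrow> nat) \<Rightarrow> real mat" where
  "N_mat u b k d = mat u b (\<lambda>(i, j). real (card {l. l < k \<and> d (j, l) = i}))"

text \<open>
  For a full design that is connected, every \<open>W_plots u k d j\<close> is at most \<open>k - 1\<close>, so the inverse
  below exists.
\<close>

definition C_mat :: "nat \<Rightarrow> nat \<Rightarrow> nat \<Rightarrow> (plot \<Rightarrow> nat) \<Rightarrow> real mat" where
  "C_mat u b k d =
     2 \<cdot>\<^sub>m 1\<^sub>m u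
     - N_mat u b k d * the (mat_inverse (real k \<cdot>\<^sub>m 1\<^sub>m b - S_mat u b k d))
       * transpose_mat (N_mat u b k d)"

definition C_dual_mat :: "nat \<Rightarrow> nat \<Rightarrow> nat \<Rightarrow> (plot \<Rightarrow> nat) \<Rightarrow> real mat" where
  "C_dual_mat u b k d =
     real k \<cdot>\<^sub>m 1\<^sub>m b - S_mat u b k d
     - (1 / 2) \<cdot>\<^sub>m (transpose_mat (N_mat u b k d) * N_mat u b k d)"

definition is_mp_inverse :: "real mat \<Rightarrow> real mat \<Rightarrow> bool" where
  "is_mp_inverse A X \<longleftrightarrow>
     X \<in> carrier_mat (dim_col A) (dim_row A) \<and>
     A * X * A = A \<and> X * A * X = X \<and>
     transpose_mat (A * X) = A * X \<and> transpose_mat (X * A) = X * A"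

definition mp_inverse :: "real mat \<Rightarrow> real mat" where
  "mp_inverse A = (THE X. is_mp_inverse A X)"

definition mat_trace :: "real mat \<Rightarrow> real" where
  "mat_trace A = (\<Sum>i<dim_row A. A $$ (i, i))"

definition A_value :: "nat \<Rightarrow> nat \<Rightarrow> nat \<Rightarrow> nat \<Rightarrow> (plot \<Rightarrow> nat) \<Rightarrow> real" where
  "A_value u w b k d =
     1 / 2 * real w * (3 * real u + 2 * real w - real b - 1)
     + real u * mat_trace (mp_inverse (C_mat u b k d))
     + 1 / 2 * real k *
         (real w * mat_trace (mp_inverse (C_dual_mat u b k d))
          + real b * mat_trace (mp_inverse (C_dual_mat u b k d) * S_mat u b k d))"

end

theory Submission
  imports Defs "Jordan_Normal_Form.Determinant"
begin

text \<open>
  Let \<open>F\<close> be the full \<open>v \<times> b\<close> incidence matrix and \<open>R\<close> the diagonal matrix of replications. Since the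
  treatments in \<open>W\<close> occur once, \<open>k I - F\<^sup>T R\<^sup>-\<^sup>1 F\<close> equals the dual information matrix of the
  subdesign. Connectedness makes its kernel the constants, so with its Moore--Penrose inverse \<open>G\<close> the
  normal equations are solved by \<open>V = R\<^sup>-\<^sup>1 + L G L\<^sup>T\<close>, \<open>L = R\<^sup>-\<^sup>1 F\<close>: the BLUE of \<open>\<tau> i - \<tau> j\<close> has
  coefficients in the row space of the model and variance
  \<open>\<sigma>\<^sup>2 (V i i + V j j - V i j - V j i)\<close>. Summing over all pairs gives
  \<open>\<sigma>\<^sup>2 (v tr V - 1\<^sup>T V 1)\<close>. The double centring of the \<open>U\<close> block of \<open>V\<close> is \<open>C\<^sup>+\<close>, and the quadratic
  form \<open>s\<^sup>T G s\<close> that occurs in both \<open>1\<^sup>T V 1\<close> and \<open>tr C\<^sup>+\<close> cancels.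
\<close>

section \<open>Moore--Penrose inverses of centred matrices\<close>

lemma mat_mult_mat:
  "mat n m f * mat m p g = mat n p (\<lambda>(i, l). \<Sum>j<m. f (i, j) * g (j, l))"
  by (rule eq_matI) (auto simp: scalar_prod_def lessThan_atLeast0)

text \<open>A right inverse of a square matrix over a field is two-sided. This excludes the result
  \<open>None\<close>, and uniqueness of inverses identifies the result with
  \<open>B\<close>.\<close>

lemma the_mat_inverse_eq:
  fixes A B :: "'a :: field mat"
  assumes A: "A \<in> carrier_mat n n" and B: "B \<in> carrier_mat n n" and AB: "A * B = 1\<^sub>m n"
  shows "the (mat_inverse A) = B"
proof (cases "mat_inverse A")
  case None
  have "B * A = 1\<^sub>m n" by (rule mat_mult_left_right_inverse[OF A B AB])
  then have "A \<in> Units (ring_mat TYPE('a) n ())"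
    using A B AB by (auto simp: Units_def ring_mat_def)
  with mat_inverse(1)[OF A None, of "()"] show ?thesis by blast
next
  case (Some X)
  then have X: "X * A = 1\<^sub>m n" "X \<in> carrier_mat n n" using mat_inverse(2)[OF A] by auto
  have "X = X * (A * B)" using X AB by simp
  also have "\<dots> = X * A * B" by (rule assoc_mult_mat[OF X(2) A B, symmetric])
  also have "\<dots> = B" using X B by simp
  finally show ?thesis using Some by simp
qed

text \<open>Transposing \<open>A * X = (A * Z) * (A * X)\<close> swaps the two symmetric factors,
  which gives \<open>A * X = A * Z\<close>; dually \<open>X * A = Z * A\<close>. Then
  \<open>X = X * A * X\<close> can be rewritten into \<open>Z\<close> one side at a time.\<close>

lemma is_mp_inverse_unique:
  assumes X: "is_mp_inverse A X" and Z: "is_mp_inverse A Z"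
  shows "X = Z"
proof -
  obtain n m where A: "A \<in> carrier_mat n m" by blast
  then have Xc: "X \<in> carrier_mat m n" and Zc: "Z \<in> carrier_mat m n"
    using X Z by (auto simp: is_mp_inverse_def)
  have AX: "A * X \<in> carrier_mat n n" and AZ: "A * Z \<in> carrier_mat n n"
    and XA: "X * A \<in> carrier_mat m m" and ZA: "Z * A \<in> carrier_mat m m"
    using A Xc Zc by auto
  have "A * X = (A * Z * A) * X" using Z by (simp add: is_mp_inverse_def)
  also have "\<dots> = (A * Z) * (A * X)" by (rule assoc_mult_mat[OF AZ A Xc])
  finally have "transpose_mat (A * X) = transpose_mat (A * X) * transpose_mat (A * Z)"
    using transpose_mult[OF AZ AX] by simp
  then have "A * X = (A * X) * (A * Z)" using X Z by (simp add: is_mp_inverse_def)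
  also have "\<dots> = (A * X * A) * Z" by (rule assoc_mult_mat[OF AX A Zc, symmetric])
  also have "\<dots> = A * Z" using X by (simp add: is_mp_inverse_def)
  finally have AXZ: "A * X = A * Z" .
  have "X * A = X * (A * Z * A)" using Z by (simp add: is_mp_inverse_def)
  also have "\<dots> = X * (A * (Z * A))" by (simp only: assoc_mult_mat[OF A Zc A])
  also have "\<dots> = (X * A) * (Z * A)" by (rule assoc_mult_mat[OF Xc A ZA, symmetric])
  finally have "transpose_mat (X * A) = transpose_mat (Z * A) * transpose_mat (X * A)"
    using transpose_mult[OF XA ZA] by simp
  then have "X * A = (Z * A) * (X * A)" using X Z by (simp add: is_mp_inverse_def)
  also have "\<dots> = Z * (A * (X * A))" by (rule assoc_mult_mat[OF Zc A XA])
  also have "\<dots> = Z * (A * X * A)" by (simp only: assoc_mult_mat[OF A Xc A])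
  also have "\<dots> = Z * A" using X by (simp add: is_mp_inverse_def)
  finally have XZA: "X * A = Z * A" .
  have "X = X * A * X" using X by (simp add: is_mp_inverse_def)
  also have "\<dots> = Z * (A * X)" unfolding XZA by (rule assoc_mult_mat[OF Zc A Xc])
  also have "\<dots> = Z * A * Z" unfolding AXZ by (rule assoc_mult_mat[OF Zc A Zc, symmetric])
  also have "\<dots> = Z" using Z by (simp add: is_mp_inverse_def)
  finally show ?thesis .
qed

lemma mp_inverse_eqI: "is_mp_inverse A X \<Longrightarrow> mp_inverse A = X"
  unfolding mp_inverse_def by (blast intro: is_mp_inverse_unique)

text \<open>Both products of \<open>f\<close> and \<open>g\<close> are the centring projection
  \<open>I - J / n\<close>. It is symmetric and fixes every symmetric matrix with zero row sums, so
  all four Penrose equations follow.\<close>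

lemma mp_inverse_centred:
  fixes f g :: "nat \<Rightarrow> nat \<Rightarrow> real"
  assumes f_sym: "\<And>i j. i < n \<Longrightarrow> j < n \<Longrightarrow> f i j = f j i"
    and g_sym: "\<And>i j. i < n \<Longrightarrow> j < n \<Longrightarrow> g i j = g j i"
    and f_rows: "\<And>i. i < n \<Longrightarrow> (\<Sum>j<n. f i j) = 0"
    and g_rows: "\<And>i. i < n \<Longrightarrow> (\<Sum>j<n. g i j) = 0"
    and fg: "\<And>i l. i < n \<Longrightarrow> l < n \<Longrightarrow> (\<Sum>j<n. f i j * g j l) = of_bool (i = l) - 1 / n"
  shows "mp_inverse (mat n n (\<lambda>(i, j). f i j)) = mat n n (\<lambda>(i, j). g i j)"
proof (rule mp_inverse_eqI)
  let ?A = "mat n n (\<lambda>(i, j). f i j)" and ?X = "mat n n (\<lambda>(i, j). g i j)"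
  let ?P = "mat n n (\<lambda>(i, j). of_bool (i = j) - 1 / real n)"
  have AX: "?A * ?X = ?P"
    unfolding mat_mult_mat by (rule cong_mat) (auto simp: fg)
  have XA: "?X * ?A = ?P"
    unfolding mat_mult_mat
  proof (rule cong_mat)
    fix i j assume "i < n" "j < n"
    then have "(\<Sum>m<n. g i m * f m j) = (\<Sum>m<n. f j m * g m i)"
      by (intro sum.cong) (auto simp: f_sym[of j] g_sym[of i])
    then show "(case (i, j) of (i, l) \<Rightarrow> \<Sum>m<n. (case (i, m) of (i, j) \<Rightarrow> g i j) * (case (m, l) of (i, j) \<Rightarrow> f i j))
        = (case (i, j) of (i, j) \<Rightarrow> of_bool (i = j) - 1 / real n)"
      using fg[of j i] \<open>i < n\<close> \<open>j < n\<close> by auto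
  qed auto
  have centre: "?P * mat n n (\<lambda>(i, j). h i j) = mat n n (\<lambda>(i, j). h i j)"
    if "\<And>i j. i < n \<Longrightarrow> j < n \<Longrightarrow> h i j = h j i" and "\<And>i. i < n \<Longrightarrow> (\<Sum>j<n. h i j) = 0"
    for h :: "nat \<Rightarrow> nat \<Rightarrow> real"
    unfolding mat_mult_mat
  proof (rule cong_mat)
    fix i l assume il: "i < n" "l < n"
    have col: "(\<Sum>j<n. h j l) = 0"
      using that(2)[OF il(2)] sum.cong[OF refl, of "{..<n}" "\<lambda>j. h j l" "h l"] that(1) il by simp
    have "(\<Sum>j<n. (of_bool (i = j) - 1 / n) * h j l)
        = (\<Sum>j<n. of_bool (i = j) * h j l) - (1 / n) * (\<Sum>j<n. h j l)"
      by (simp add: left_diff_distrib sum_subtractf sum_distrib_left)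
    also have "\<dots> = h i l" using il col by simp
    finally show "(case (i, l) of (i, l) \<Rightarrow> \<Sum>j<n. (case (i, j) of (i, j) \<Rightarrow> of_bool (i = j) - 1 / real n)
        * (case (j, l) of (i, j) \<Rightarrow> h i j)) = (case (i, l) of (i, j) \<Rightarrow> h i j)"
      by simp
  qed auto
  have "transpose_mat ?P = ?P" by (rule eq_matI) auto
  then show "is_mp_inverse ?A ?X"
    unfolding is_mp_inverse_def AX XA
    using centre[OF f_sym f_rows] centre[OF g_sym g_rows] by simp
qed

lemma centred_inverse_exists:
  fixes f :: "nat \<Rightarrow> nat \<Rightarrow> real"
  assumes n: "n > 0"
    and f_sym: "\<And>i j. i < n \<Longrightarrow> j < n \<Longrightarrow> f i j = f j i"
    and f_rows: "\<And>i. i < n \<Longrightarrow> (\<Sum>j<n. f i j) = 0"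
    and f_kernel: "\<And>x. (\<And>i. i < n \<Longrightarrow> (\<Sum>j<n. f i j * x j) = 0) \<Longrightarrow> \<exists>c. \<forall>j<n. x j = c"
  obtains g where "\<And>i j. i < n \<Longrightarrow> j < n \<Longrightarrow> g i j = g j i"
    and "\<And>i. i < n \<Longrightarrow> (\<Sum>j<n. g i j) = 0"
    and "\<And>i l. i < n \<Longrightarrow> l < n \<Longrightarrow> (\<Sum>j<n. f i j * g j l) = of_bool (i = l) - 1 / n"
proof -
  \<comment> \<open>Adding the rank-one matrix \<open>J / n\<close> removes the kernel, so \<open>g = (f + J / n)\<^sup>-\<^sup>1 - J / n\<close> works.\<close>
  let ?B = "mat n n (\<lambda>(i, j). f i j + 1 / real n)"
  have f_cols: "(\<Sum>i<n. f i j) = 0" if "j < n" for j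
    using f_rows[OF that] sum.cong[OF refl, of "{..<n}" "\<lambda>i. f i j" "f j"] f_sym that by simp
  have "det ?B \<noteq> 0"
  proof
    assume "det ?B = 0"
    then obtain x where x: "x \<in> carrier_vec n" "x \<noteq> 0\<^sub>v n" "?B *\<^sub>v x = 0\<^sub>v n"
      using det_0_iff_vec_prod_zero_field[of ?B n] by auto
    define y where "y j = x $ j" for j
    have Bx: "(\<Sum>j<n. f i j * y j) + (\<Sum>j<n. y j) / n = 0" if "i < n" for i
    proof -
      have "(?B *\<^sub>v x) $ i = 0" using x that by simp
      then have "(\<Sum>j<n. (f i j + 1 / n) * y j) = 0"
        using that x(1) by (simp add: scalar_prod_def lessThan_atLeast0 y_def)
      then show ?thesis
        by (simp add: distrib_right sum.distrib sum_divide_distrib)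
    qed
    \<comment> \<open>Summing the equations \<open>Bx\<close> over all rows: the columns of
      \<open>f\<close> sum to zero, so only the rank-one part survives and the entries of
      \<open>y\<close> sum to zero. Hence \<open>y\<close> lies in the kernel of \<open>f\<close>
      itself.\<close>
    have "(\<Sum>i<n. \<Sum>j<n. f i j * y j) = (\<Sum>j<n. (\<Sum>i<n. f i j) * y j)"
      by (subst sum.swap) (simp add: sum_distrib_right)
    also have "\<dots> = 0" by (simp add: f_cols)
    finally have "(\<Sum>i<n. (\<Sum>j<n. f i j * y j) + (\<Sum>j<n. y j) / n) = (\<Sum>j<n. y j)"
      using n by (simp add: sum.distrib)
    moreover have "(\<Sum>i<n. (\<Sum>j<n. f i j * y j) + (\<Sum>j<n. y j) / n) = 0"
      by (rule sum.neutral) (auto simp: Bx)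
    ultimately have s0: "(\<Sum>j<n. y j) = 0" by simp
    then obtain c where c: "\<forall>j<n. y j = c"
      using f_kernel[of y] Bx by auto
    with s0 n have "c = 0" by simp
    with c x(1) have "x = 0\<^sub>v n" by (intro eq_vecI) (auto simp: y_def)
    with x(2) show False by simp
  qed
  then obtain H where H: "H \<in> carrier_mat n n" "?B * H = 1\<^sub>m n" "H * ?B = 1\<^sub>m n"
    using det_non_zero_imp_unit[of ?B n "()"] by (auto simp: Units_def ring_mat_def)
  define h where "h i j = H $$ (i, j)" for i j
  have Bh: "(\<Sum>j<n. f i j * h j l) + (\<Sum>j<n. h j l) / n = of_bool (i = l)"
    if "i < n" "l < n" for i l
  proof -
    have "(?B * H) $$ (i, l) = of_bool (i = l)" using H that by simp
    then have "(\<Sum>j<n. (f i j + 1 / n) * h j l) = of_bool (i = l)"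
      using that H(1) by (simp add: scalar_prod_def lessThan_atLeast0 h_def)
    then show ?thesis
      by (simp add: distrib_right sum.distrib sum_divide_distrib)
  qed
  have h_cols: "(\<Sum>j<n. h j l) = 1" if "l < n" for l
  proof -
    have "(\<Sum>i<n. \<Sum>j<n. f i j * h j l) = (\<Sum>j<n. (\<Sum>i<n. f i j) * h j l)"
      by (subst sum.swap) (simp add: sum_distrib_right)
    also have "\<dots> = 0" by (simp add: f_cols)
    finally have "(\<Sum>i<n. (\<Sum>j<n. f i j * h j l) + (\<Sum>j<n. h j l) / n) = (\<Sum>j<n. h j l)"
      using n by (simp add: sum.distrib)
    moreover have "(\<Sum>i<n. (\<Sum>j<n. f i j * h j l) + (\<Sum>j<n. h j l) / n) = 1"
      using that by (simp add: Bh)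
    ultimately show ?thesis by simp
  qed
  have Bt: "transpose_mat ?B = ?B" by (rule eq_matI) (auto simp: f_sym)
  \<comment> \<open>\<open>H\<close> is symmetric because its transpose is also a left inverse of
    the symmetric matrix \<open>?B\<close>.\<close>
  have "transpose_mat H * ?B = 1\<^sub>m n"
    using arg_cong[OF H(2), of transpose_mat] transpose_mult[of ?B n n H n] H(1) Bt by simp
  then have "transpose_mat H = transpose_mat H * (?B * H)"
    using H by simp
  also have "\<dots> = (transpose_mat H * ?B) * H"
    using H(1) by (intro assoc_mult_mat[symmetric]) auto
  also have "\<dots> = H" using H(1) \<open>transpose_mat H * ?B = 1\<^sub>m n\<close> by simp
  finally have "transpose_mat H = H" .
  then have h_sym: "h i j = h j i" if "i < n" "j < n" for i j
    using that H(1) index_transpose_mat(1)[of i H j] unfolding h_def by simp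
  have h_rows: "(\<Sum>j<n. h i j) = 1" if "i < n" for i
    using h_cols[OF that] sum.cong[OF refl, of "{..<n}" "\<lambda>j. h j i" "h i"] h_sym that by simp
  show ?thesis
  proof (rule that)
    show "h i j - 1 / n = h j i - 1 / n" if "i < n" "j < n" for i j
      using h_sym that by simp
    show "(\<Sum>j<n. h i j - 1 / n) = 0" if "i < n" for i
      using h_rows[OF that] n by (simp add: sum_subtractf)
    show "(\<Sum>j<n. f i j * (h j l - 1 / n)) = of_bool (i = l) - 1 / n" if "i < n" "l < n" for i l
      using Bh[OF that] h_cols[OF that(2)] f_rows[OF that(1)] that
      by (simp add: right_diff_distrib sum_subtractf flip: sum_divide_distrib)
  qed
qed

section \<open>Incidence and normal equations\<close>

lemma sum_mult_swap:
  fixes f :: "'a \<Rightarrow> real"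
  shows "(\<Sum>t\<in>A. f t * (\<Sum>j\<in>B. g t j)) = (\<Sum>j\<in>B. \<Sum>t\<in>A. f t * g t j)"
  unfolding sum_distrib_left by (rule sum.swap)

locale block_design =
  fixes u w b k :: nat and d :: "plot \<Rightarrow> nat"
  assumes full: "full_design u w b k d"
    and u_pos: "u > 0" and b_pos: "b > 0" and k_pos: "k > 0"
begin

abbreviation v :: nat where "v \<equiv> u + w"

definition cell :: "nat \<Rightarrow> nat \<Rightarrow> real" where
  "cell t j = real (card {l. l < k \<and> d (j, l) = t})"

definition rep :: "nat \<Rightarrow> real" where
  "rep t = (if t < u then 2 else 1)"

definition L :: "nat \<Rightarrow> nat \<Rightarrow> real" where
  "L t j = cell t j / rep t"

definition s :: "nat \<Rightarrow> real" where
  "s j = real (W_plots u k d j)"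

definition C_dual :: "nat \<Rightarrow> nat \<Rightarrow> real" where
  "C_dual j l = k * of_bool (j = l) - (\<Sum>t<v. cell t j * L t l)"

lemma rep_pos: "rep t > 0"
  by (simp add: rep_def)

lemma cell_eq: "cell t j = rep t * L t j"
  using rep_pos[of t] by (simp add: L_def)

lemma C_dual_sym: "C_dual j l = C_dual l j"
  by (simp add: C_dual_def cell_eq mult.commute mult.left_commute eq_commute[of j])

lemma plots_count: "b * k = 2 * u + w"
  using full by (simp add: full_design_def)

text \<open>Groups the plots of a block by treatment; a full design assigns only treatments below
  \<open>v\<close>, so no plot is lost. All later passages from plots to incidence numbers rest on
  this.\<close>

lemma sum_block:
  assumes "j < b"
  shows "(\<Sum>l<k. f (d (j, l))) = (\<Sum>t<v. cell t j * f t)"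
proof -
  have "(\<Sum>l<k. f (d (j, l))) = (\<Sum>t<v. \<Sum>l | l \<in> {..<k} \<and> d (j, l) = t. f (d (j, l)))"
    using full assms by (intro sum.group[symmetric]) (auto simp: full_design_def plots_def)
  also have "\<dots> = (\<Sum>t<v. cell t j * f t)"
    by (intro sum.cong) (auto simp: cell_def)
  finally show ?thesis .
qed

lemma sum_plots:
  "(\<Sum>p\<in>plots b k. f (d p) (fst p)) = (\<Sum>t<v. \<Sum>j<b. cell t j * f t j)"
proof -
  have "(\<Sum>p\<in>plots b k. f (d p) (fst p)) = (\<Sum>j<b. \<Sum>l<k. f (d (j, l)) j)"
    unfolding plots_def by (simp add: sum.cartesian_product case_prod_unfold)
  also have "\<dots> = (\<Sum>j<b. \<Sum>t<v. cell t j * f t j)"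
    by (rule sum.cong[OF refl]) (simp add: sum_block[of _ "\<lambda>t. f t _"])
  also have "\<dots> = (\<Sum>t<v. \<Sum>j<b. cell t j * f t j)" by (rule sum.swap)
  finally show ?thesis .
qed

lemma finite_plots: "finite (plots b k)"
  by (simp add: plots_def)

lemma cell_row_sum:
  assumes "t < v"
  shows "(\<Sum>j<b. cell t j) = rep t"
proof -
  have "card {p \<in> plots b k. d p = t} = (if t < u then 2 else 1)"
    using full assms by (auto simp: full_design_def)
  then have "rep t = real (card {p \<in> plots b k. d p = t})"
    by (simp add: rep_def)
  also have "\<dots> = (\<Sum>p\<in>plots b k. of_bool (d p = t))"
    by (simp add: finite_plots Int_def)
  also have "\<dots> = (\<Sum>t'<v. \<Sum>j<b. cell t' j * of_bool (t' = t))"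
    by (rule sum_plots[of "\<lambda>t' j. of_bool (t' = t)"])
  also have "\<dots> = (\<Sum>t'<v. of_bool (t' = t) * (\<Sum>j<b. cell t' j))"
    by (simp add: sum_distrib_left mult.commute)
  also have "\<dots> = (\<Sum>j<b. cell t j)" using assms by simp
  finally show ?thesis by simp
qed

lemma cell_col_sum: "j < b \<Longrightarrow> (\<Sum>t<v. cell t j) = k"
  using sum_block[of j "\<lambda>_. 1"] by simp

lemma L_row_sum: "t < v \<Longrightarrow> (\<Sum>j<b. L t j) = 1"
  using cell_row_sum[of t] rep_pos[of t] by (simp add: L_def flip: sum_divide_distrib)

lemma W_cell_sum:
  assumes "j < b"
  shows "(\<Sum>t=u..<v. cell t j) = s j"
proof -
  have "s j = (\<Sum>l<k. of_bool (u \<le> d (j, l)))"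
    by (simp add: s_def W_plots_def Int_def)
  also have "\<dots> = (\<Sum>t<v. cell t j * of_bool (u \<le> t))"
    by (rule sum_block[OF assms])
  also have "\<dots> = (\<Sum>t=u..<v. cell t j)"
    by (intro sum.mono_neutral_cong_right) auto
  finally show ?thesis by simp
qed

lemma split_treatments: "(\<Sum>t<v. f t) = (\<Sum>t<u. f t) + (\<Sum>t=u..<v. f t)" for f :: "nat \<Rightarrow> real"
  using sum.atLeastLessThan_concat[of 0 u v f] by (simp add: lessThan_atLeast0)

lemma U_cell_sum: "j < b \<Longrightarrow> (\<Sum>t<u. cell t j) = k - s j"
  using cell_col_sum[of j] W_cell_sum[of j] split_treatments[of "\<lambda>t. cell t j"] by simp

text \<open>A row of natural numbers with sum one has a single entry one and zeros elsewhere. The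
  row is therefore read back in \<open>nat\<close>, as \<open>c\<close>, before
  \<open>sum_eq_1_iff\<close> is applied.\<close>

lemma W_cell_mult:
  assumes "t \<in> {u..<v}" "j < b" "l < b"
  shows "cell t j * cell t l = of_bool (j = l) * cell t j"
proof -
  define c where "c j = card {l. l < k \<and> d (j, l) = t}" for j
  have "real (\<Sum>j<b. c j) = 1"
    using cell_row_sum[of t] assms by (simp add: cell_def c_def rep_def)
  then have "(\<Sum>j<b. c j) = 1" by linarith
  then obtain j0 where "c j0 = 1" "\<forall>j<b. j0 \<noteq> j \<longrightarrow> c j = 0"
    using sum_eq_1_iff[of "{..<b}" c] by auto
  then show ?thesis using assms
    by (cases "j = j0"; cases "l = j0") (auto simp: cell_def simp flip: c_def)
qed

lemma W_L: "t \<in> {u..<v} \<Longrightarrow> L t j = cell t j"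
  by (simp add: L_def rep_def)

lemma U_L: "t < u \<Longrightarrow> L t j = cell t j / 2"
  by (simp add: L_def rep_def)

lemma W_gram:
  assumes "j < b" "l < b"
  shows "(\<Sum>t=u..<v. cell t j * cell t l) = of_bool (j = l) * s j"
  using assms by (simp add: W_cell_mult W_cell_sum flip: sum_distrib_left)

text \<open>By \<open>W_gram\<close> the treatments in \<open>W\<close> contribute only a diagonal
  matrix, which turns \<open>k\<close> into \<open>k - s j\<close>. So the full design and its
  subdesign share one dual information matrix.\<close>

lemma C_dual_eq:
  assumes "j < b" "l < b"
  shows "C_dual j l = of_bool (j = l) * (k - s j) - 1 / 2 * (\<Sum>t<u. cell t j * cell t l)"
proof -
  have "(\<Sum>t<v. cell t j * L t l) = 1 / 2 * (\<Sum>t<u. cell t j * cell t l) + (\<Sum>t=u..<v. cell t j * cell t l)"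
    unfolding split_treatments sum_distrib_left by (intro arg_cong2[of _ _ _ _ "(+)"] sum.cong) (auto simp: W_L U_L)
  then show ?thesis
    by (simp add: C_dual_def W_gram[OF assms] algebra_simps)
qed

lemma C_dual_row_sum:
  assumes "j < b"
  shows "(\<Sum>l<b. C_dual j l) = 0"
proof -
  have "(\<Sum>l<b. \<Sum>t<v. cell t j * L t l) = (\<Sum>t<v. cell t j * (\<Sum>l<b. L t l))"
    by (rule sum_mult_swap[symmetric])
  also have "\<dots> = k" using assms by (simp add: L_row_sum cell_col_sum)
  finally show ?thesis using assms by (simp add: C_dual_def sum_subtractf flip: sum_distrib_left)
qed

text \<open>The inner product of two vectors that are additive in treatment and block. The factors
  of \<open>\<tau> t\<close> and \<open>\<beta> j\<close> are the left-hand sides of the treatment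
  and block normal equations at \<open>\<theta>\<close>, \<open>\<phi>\<close>.\<close>

lemma sum_plots_additive:
  fixes \<theta> \<phi> \<tau> \<beta> :: "nat \<Rightarrow> real"
  shows "(\<Sum>p\<in>plots b k. (\<theta> (d p) + \<phi> (fst p)) * (\<tau> (d p) + \<beta> (fst p)))
    = (\<Sum>t<v. \<tau> t * (rep t * \<theta> t + (\<Sum>j<b. cell t j * \<phi> j)))
    + (\<Sum>j<b. \<beta> j * ((\<Sum>t<v. cell t j * \<theta> t) + k * \<phi> j))"
proof -
  have "(\<Sum>p\<in>plots b k. (\<theta> (d p) + \<phi> (fst p)) * (\<tau> (d p) + \<beta> (fst p)))
    = (\<Sum>t<v. \<Sum>j<b. cell t j * ((\<theta> t + \<phi> j) * (\<tau> t + \<beta> j)))"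
    by (rule sum_plots[of "\<lambda>t j. (\<theta> t + \<phi> j) * (\<tau> t + \<beta> j)"])
  also have "\<dots> = (\<Sum>t<v. \<Sum>j<b. \<tau> t * (cell t j * (\<theta> t + \<phi> j)))
    + (\<Sum>t<v. \<Sum>j<b. \<beta> j * (cell t j * (\<theta> t + \<phi> j)))"
    by (simp add: algebra_simps sum.distrib)
  also have "(\<Sum>t<v. \<Sum>j<b. \<tau> t * (cell t j * (\<theta> t + \<phi> j)))
    = (\<Sum>t<v. \<tau> t * ((\<Sum>j<b. cell t j) * \<theta> t + (\<Sum>j<b. cell t j * \<phi> j)))"
    by (simp add: distrib_left sum.distrib sum_distrib_left sum_distrib_right mult.assoc)
  also have "\<dots> = (\<Sum>t<v. \<tau> t * (rep t * \<theta> t + (\<Sum>j<b. cell t j * \<phi> j)))"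
    by (simp add: cell_row_sum)
  also have "(\<Sum>t<v. \<Sum>j<b. \<beta> j * (cell t j * (\<theta> t + \<phi> j)))
    = (\<Sum>j<b. \<beta> j * ((\<Sum>t<v. cell t j * \<theta> t) + (\<Sum>t<v. cell t j) * \<phi> j))"
    by (subst sum.swap)
      (simp add: distrib_left sum.distrib sum_distrib_left sum_distrib_right mult.assoc)
  also have "\<dots> = (\<Sum>j<b. \<beta> j * ((\<Sum>t<v. cell t j * \<theta> t) + k * \<phi> j))"
    by (simp add: cell_col_sum)
  finally show ?thesis .
qed

text \<open>Eliminates the treatment effects from the normal equations: \<open>x t - (\<Sum>l<b. L t l * \<phi> l)\<close> is the
  treatment effect forced by the treatment equation with right-hand side \<open>rep t * x t\<close>.\<close>

lemma reduced_block_equation: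
  fixes x \<phi> :: "nat \<Rightarrow> real"
  assumes "j < b"
  shows "(\<Sum>t<v. cell t j * (x t - (\<Sum>l<b. L t l * \<phi> l))) + k * \<phi> j
    = (\<Sum>t<v. cell t j * x t) + (\<Sum>l<b. C_dual j l * \<phi> l)"
proof -
  have "(\<Sum>t<v. cell t j * (\<Sum>l<b. L t l * \<phi> l)) = (\<Sum>l<b. (\<Sum>t<v. cell t j * L t l) * \<phi> l)"
    by (simp add: sum_mult_swap sum_distrib_right mult.assoc)
  moreover have "(\<Sum>l<b. C_dual j l * \<phi> l)
    = k * \<phi> j - (\<Sum>l<b. (\<Sum>t<v. cell t j * L t l) * \<phi> l)"
    using assms by (simp add: C_dual_def left_diff_distrib sum_subtractf mult.assoc flip: sum_distrib_left)
  ultimately show ?thesis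
    by (simp add: right_diff_distrib sum_subtractf)
qed

end

section \<open>Consequences of connectedness\<close>

locale connected_block_design = block_design +
  assumes connected: "i < u + w \<Longrightarrow> j < u + w \<Longrightarrow>
    \<exists>c :: plot \<Rightarrow> real. \<forall>\<tau> \<beta> :: nat \<Rightarrow> real. (\<Sum>p\<in>plots b k. c p * (\<tau> (d p) + \<beta> (fst p))) = \<tau> i - \<tau> j"
begin

text \<open>A kernel vector \<open>\<phi>\<close>, completed by
  \<open>\<theta> = - L \<phi>\<close>, solves the homogeneous normal equations. Its fitted vector
  then has squared norm zero, so it vanishes on every plot.\<close>

lemma C_dual_kernel:
  fixes \<phi> :: "nat \<Rightarrow> real"
  assumes "\<And>j. j < b \<Longrightarrow> (\<Sum>l<b. C_dual j l * \<phi> l) = 0"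
  shows "\<exists>c. \<forall>j<b. \<phi> j = c"
proof -
  define \<theta> where "\<theta> t = - (\<Sum>l<b. L t l * \<phi> l)" for t
  have 1: "rep t * \<theta> t + (\<Sum>j<b. cell t j * \<phi> j) = 0" for t
    by (simp add: \<theta>_def cell_eq sum_distrib_left mult.assoc)
  have 2: "(\<Sum>t<v. cell t j * \<theta> t) + k * \<phi> j = 0" if "j < b" for j
    using reduced_block_equation[OF that, of "\<lambda>_. 0" \<phi>] assms[OF that]
    by (simp add: \<theta>_def)
  have "(\<Sum>p\<in>plots b k. (\<theta> (d p) + \<phi> (fst p)) * (\<theta> (d p) + \<phi> (fst p))) = 0"
    unfolding sum_plots_additive using 1 2 by simp
  then have fit: "\<theta> (d p) + \<phi> (fst p) = 0" if "p \<in> plots b k" for p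
    using that finite_plots by (subst (asm) sum_nonneg_eq_0_iff) auto
  \<comment> \<open>An unbiased linear estimator of \<open>\<tau> t - \<tau> 0\<close>, evaluated at
    the vanishing fitted vector, returns both zero and
    \<open>\<theta> t - \<theta> 0\<close>.\<close>
  have \<theta>: "\<theta> t = \<theta> 0" if t: "t < v" for t
  proof -
    obtain c :: "plot \<Rightarrow> real"
      where "\<forall>\<tau> \<beta>. (\<Sum>p\<in>plots b k. c p * (\<tau> (d p) + \<beta> (fst p))) = \<tau> t - \<tau> 0"
      using connected[of t 0] u_pos t by auto
    then have "(\<Sum>p\<in>plots b k. c p * (\<theta> (d p) + \<phi> (fst p))) = \<theta> t - \<theta> 0"
      by blast
    then show ?thesis using fit by simp
  qed
  have "\<phi> j = - \<theta> 0" if "j < b" for j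
  proof -
    have p: "(j, 0) \<in> plots b k" using that k_pos by (simp add: plots_def)
    then have "d (j, 0) < v" using full by (simp add: full_design_def)
    with fit[OF p] \<theta>[of "d (j, 0)"] show ?thesis by simp
  qed
  then show ?thesis by blast
qed

text \<open>If block \<open>j\<close> held only treatments of \<open>W\<close>, column
  \<open>j\<close> of \<open>C_dual\<close> would vanish and the indicator of \<open>j\<close> would
  be a kernel vector, hence constant. Then \<open>j\<close> is the only block, and treatment 0 in
  \<open>U\<close> has no plot.\<close>

lemma W_plots_less:
  assumes "j < b"
  shows "s j < k"
proof (rule ccontr)
  assume "\<not> s j < k"
  moreover have nonneg: "\<forall>t\<in>{..<u}. cell t j \<ge> 0" by (simp add: cell_def)
  ultimately have s: "s j = k" and "(\<Sum>t<u. cell t j) = 0"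
    using U_cell_sum[OF assms] sum_nonneg[of "{..<u}" "\<lambda>t. cell t j"] by auto
  with nonneg have cell0: "\<forall>t\<in>{..<u}. cell t j = 0"
    by (subst (asm) sum_nonneg_eq_0_iff) auto
  have "C_dual i j = 0" if "i < b" for i
    using that assms s cell0 by (simp add: C_dual_eq)
  then have "\<exists>c. \<forall>i<b. of_bool (i = j) = (c :: real)"
    using assms by (intro C_dual_kernel) simp
  then obtain c :: real where c: "\<forall>i<b. of_bool (i = j) = c" by blast
  with assms have "c = 1" by auto
  with c have all: "i = j" if "i < b" for i using that by (metis of_bool_eq_1_iff)
  have "rep 0 = (\<Sum>i<b. cell 0 i)" using cell_row_sum[of 0] u_pos by simp
  also have "\<dots> = 0" using all cell0 u_pos by (intro sum.neutral) auto
  finally show False using rep_pos[of 0] by simp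
qed

end

section \<open>Minimum-norm unbiased coefficients\<close>

text \<open>The three assumptions make \<open>G\<close> the Moore--Penrose inverse of
  \<open>C_dual\<close>, by \<open>mp_inverse_centred\<close>.\<close>

locale block_design_dual_inverse = connected_block_design +
  fixes G :: "nat \<Rightarrow> nat \<Rightarrow> real"
  assumes G_sym: "i < b \<Longrightarrow> j < b \<Longrightarrow> G i j = G j i"
    and G_row_sum: "i < b \<Longrightarrow> (\<Sum>j<b. G i j) = 0"
    and C_dual_G: "i < b \<Longrightarrow> l < b \<Longrightarrow> (\<Sum>j<b. C_dual i j * G j l) = of_bool (i = l) - 1 / b"
begin

text \<open>Up to sign, these are the block effects that accompany column \<open>t\<close> of
  \<open>V\<close> in a solution of the normal equations.\<close>

definition GL :: "nat \<Rightarrow> nat \<Rightarrow> real" where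
  "GL j t = (\<Sum>l<b. G j l * L t l)"

definition V :: "nat \<Rightarrow> nat \<Rightarrow> real" where
  "V i t = of_bool (i = t) / rep i + (\<Sum>j<b. L i j * GL j t)"

lemma V_sym: "V i t = V t i"
proof -
  have "(\<Sum>j<b. L i j * GL j t) = (\<Sum>j<b. \<Sum>l<b. L i j * G j l * L t l)"
    by (simp add: GL_def sum_distrib_left mult.assoc)
  also have "\<dots> = (\<Sum>l<b. \<Sum>j<b. L t l * G l j * L i j)"
    by (subst sum.swap) (intro sum.cong refl, simp add: G_sym)
  also have "\<dots> = (\<Sum>j<b. L t j * GL j i)"
    by (simp add: GL_def sum_distrib_left mult.assoc)
  finally show ?thesis by (auto simp: V_def)
qed

lemma C_dual_GL:
  assumes "j < b" "t < v"
  shows "(\<Sum>l<b. C_dual j l * GL l t) = L t j - 1 / b"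
proof -
  have "(\<Sum>l<b. C_dual j l * GL l t) = (\<Sum>m<b. (\<Sum>l<b. C_dual j l * G l m) * L t m)"
    by (simp add: GL_def sum_mult_swap sum_distrib_right mult.assoc)
  also have "\<dots> = (\<Sum>m<b. of_bool (j = m) * L t m) - 1 / b * (\<Sum>m<b. L t m)"
    using assms by (simp add: C_dual_G left_diff_distrib sum_subtractf sum_distrib_left sum_divide_distrib)
  finally show ?thesis using assms by (simp add: L_row_sum)
qed

lemma treatment_equation:
  "rep t * V t i - (\<Sum>j<b. cell t j * GL j i) = of_bool (t = i)"
  using rep_pos[of t]
  by (simp add: V_def distrib_left cell_eq sum_distrib_left mult.assoc)

text \<open>The right-hand side is \<open>1 / b\<close> because \<open>G\<close> inverts
  \<open>C_dual\<close> only up to the centring projection. It does not depend on \<open>i\<close>,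
  so it cancels in every contrast.\<close>

lemma block_equation:
  assumes "j < b" "i < v"
  shows "(\<Sum>t<v. cell t j * V t i) - k * GL j i = 1 / b"
proof -
  have "(\<Sum>t<v. cell t j * V t i) - k * GL j i
      = (\<Sum>t<v. cell t j * (of_bool (t = i) / rep t)) - (\<Sum>l<b. C_dual j l * GL l i)"
    using reduced_block_equation[OF assms(1), of "\<lambda>t. of_bool (t = i) / rep t" "\<lambda>j. - GL j i"]
    by (simp add: V_def sum_negf)
  also have "(\<Sum>t<v. cell t j * (of_bool (t = i) / rep t)) = (\<Sum>t<v. of_bool (t = i) * L t j)"
    by (intro sum.cong) (auto simp: L_def)
  also have "\<dots> = L i j" using assms by simp
  finally show ?thesis using assms by (simp add: C_dual_GL)
qed

definition coeff :: "nat \<Rightarrow> nat \<Rightarrow> plot \<Rightarrow> real" where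
  "coeff i j p = (V (d p) i - V (d p) j) + (GL (fst p) j - GL (fst p) i)"

lemma coeff_unbiased:
  assumes "i < v" "j < v"
  shows "(\<Sum>p\<in>plots b k. coeff i j p * (\<tau> (d p) + \<beta> (fst p))) = \<tau> i - \<tau> j"
proof -
  have 1: "rep t * (V t i - V t j) + (\<Sum>l<b. cell t l * (GL l j - GL l i))
      = of_bool (t = i) - of_bool (t = j)" for t
    using treatment_equation[of t i] treatment_equation[of t j]
    by (simp add: right_diff_distrib sum_subtractf)
  have 2: "(\<Sum>t<v. cell t l * (V t i - V t j)) + k * (GL l j - GL l i) = 0" if "l < b" for l
    using block_equation[OF that assms(1)] block_equation[OF that assms(2)]
    by (simp add: right_diff_distrib sum_subtractf)
  show ?thesis
    unfolding coeff_def sum_plots_additive[of "\<lambda>t. V t i - V t j" "\<lambda>l. GL l j - GL l i"] 1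
    using assms by (simp add: 2) (simp add: right_diff_distrib sum_subtractf)
qed

definition pair_var :: "nat \<Rightarrow> nat \<Rightarrow> real" where
  "pair_var i j = V i i + V j j - V i j - V j i"

text \<open>The coefficients lie in the row space of the model, so every unbiased \<open>c\<close> has
  the same inner product with them.\<close>

lemma coeff_inner:
  assumes "i < v" "j < v"
    and "\<And>\<tau> \<beta>. (\<Sum>p\<in>plots b k. c p * (\<tau> (d p) + \<beta> (fst p))) = \<tau> i - \<tau> j"
  shows "(\<Sum>p\<in>plots b k. c p * coeff i j p) = pair_var i j"
  unfolding coeff_def pair_var_def
  using assms(3)[of "\<lambda>t. V t i - V t j" "\<lambda>l. GL l j - GL l i"] by simp

lemma coeff_norm:
  assumes "i < v" "j < v"
  shows "(\<Sum>p\<in>plots b k. (coeff i j p)\<^sup>2) = pair_var i j"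
  using coeff_inner[OF assms coeff_unbiased[OF assms]] by (simp add: power2_eq_square)

text \<open>Gauss--Markov as Pythagoras: \<open>coeff i j\<close> has the same inner product with
  \<open>c\<close> as with itself, so expanding the squared norm of the difference leaves the
  difference of the squared norms.\<close>

lemma coeff_minimal:
  assumes "i < v" "j < v"
    and "\<And>\<tau> \<beta>. (\<Sum>p\<in>plots b k. c p * (\<tau> (d p) + \<beta> (fst p))) = \<tau> i - \<tau> j"
  shows "pair_var i j \<le> (\<Sum>p\<in>plots b k. (c p)\<^sup>2)"
proof -
  have "0 \<le> (\<Sum>p\<in>plots b k. (c p - coeff i j p)\<^sup>2)" by (simp add: sum_nonneg)
  also have "\<dots> = (\<Sum>p\<in>plots b k. (c p)\<^sup>2) + (\<Sum>p\<in>plots b k. (coeff i j p)\<^sup>2)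
      - 2 * (\<Sum>p\<in>plots b k. c p * coeff i j p)"
    by (simp add: power2_diff sum.distrib sum_subtractf sum_distrib_left mult.assoc)
  finally show ?thesis by (simp add: coeff_inner[OF assms] coeff_norm[OF assms(1,2)])
qed

section \<open>The information matrix of the subdesign\<close>

text \<open>On \<open>U\<close>, \<open>V\<close> is a generalised inverse of \<open>C\<close>; the Moore--Penrose inverse is obtained from it
  by double centring.\<close>

definition C :: "nat \<Rightarrow> nat \<Rightarrow> real" where
  "C i l = 2 * of_bool (i = l) - (\<Sum>j<b. cell i j * cell l j / (k - s j))"

definition V_row_sum :: "nat \<Rightarrow> real" where
  "V_row_sum i = (\<Sum>l<u. V i l)"

text \<open>The product \<open>(I - J / u) V (I - J / u)\<close> on \<open>U\<close>; symmetry of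
  \<open>V\<close> lets row sums stand for column sums.\<close>

definition C_pinv :: "nat \<Rightarrow> nat \<Rightarrow> real" where
  "C_pinv i l = V i l - V_row_sum i / u - V_row_sum l / u + (\<Sum>m<u. V_row_sum m) / (real u)\<^sup>2"

lemma C_sym: "C i l = C l i"
  by (auto simp: C_def mult.commute)

lemma C_row_sum:
  assumes "i < u"
  shows "(\<Sum>l<u. C i l) = 0"
proof -
  have "(\<Sum>l<u. \<Sum>j<b. cell i j * cell l j / (k - s j))
      = (\<Sum>j<b. cell i j / (k - s j) * (\<Sum>l<u. cell l j))"
    by (subst sum.swap) (simp add: sum_distrib_left)
  also have "\<dots> = (\<Sum>j<b. cell i j)"
    using W_plots_less by (intro sum.cong) (force simp: U_cell_sum)+
  also have "\<dots> = 2" using assms cell_row_sum[of i] by (simp add: rep_def)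
  finally show ?thesis using assms by (simp add: C_def sum_subtractf flip: sum_distrib_left)
qed

text \<open>This is \<open>block_equation\<close> with the \<open>W\<close> terms moved to the
  right: as each such treatment lies in one block, together they contribute
  \<open>s j * GL j l\<close>.\<close>

lemma U_cell_V:
  assumes "j < b" "l < u"
  shows "(\<Sum>m<u. cell m j * V m l) = 1 / b + (k - s j) * GL j l"
proof -
  have "(\<Sum>t=u..<v. cell t j * V t l) = (\<Sum>t=u..<v. \<Sum>m<b. (cell t j * cell t m) * GL m l)"
    using assms by (intro sum.cong) (auto simp: V_def W_L sum_distrib_left mult.assoc)
  also have "\<dots> = (\<Sum>m<b. (\<Sum>t=u..<v. cell t j * cell t m) * GL m l)"
    by (subst sum.swap) (simp add: sum_distrib_right)
  also have "\<dots> = (\<Sum>m<b. of_bool (j = m) * (s j * GL m l))"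
    using assms by (simp add: W_gram mult.assoc)
  also have "\<dots> = s j * GL j l" using assms by simp
  finally show ?thesis
    using block_equation[of j l] assms by (simp add: split_treatments algebra_simps)
qed

text \<open>After \<open>U_cell_V\<close> is divided by \<open>k - s j\<close>, the
  \<open>GL\<close> terms cancel against \<open>treatment_equation\<close>. The remaining error
  depends on \<open>i\<close> only, so centring over \<open>l\<close> removes it.\<close>

lemma C_V:
  assumes "i < u" "l < u"
  shows "(\<Sum>m<u. C i m * V m l) = of_bool (i = l) - (\<Sum>j<b. cell i j / (b * (k - s j)))"
proof -
  have "(\<Sum>m<u. C i m * V m l)
      = (\<Sum>m<u. 2 * (of_bool (i = m) * V m l)) - (\<Sum>m<u. (\<Sum>j<b. cell i j * cell m j / (k - s j)) * V m l)"
    by (simp add: C_def left_diff_distrib sum_subtractf mult.assoc)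
  also have "(\<Sum>m<u. 2 * (of_bool (i = m) * V m l)) = 2 * V i l"
    using assms by (simp flip: sum_distrib_left)
  also have "(\<Sum>m<u. (\<Sum>j<b. cell i j * cell m j / (k - s j)) * V m l)
      = (\<Sum>j<b. cell i j / (k - s j) * (\<Sum>m<u. cell m j * V m l))"
    unfolding sum_distrib_right
    by (rule trans[OF sum.swap]) (simp add: sum_distrib_left mult.assoc)
  also have "\<dots> = (\<Sum>j<b. cell i j * GL j l + cell i j / (b * (k - s j)))"
    using W_plots_less assms(2) by (intro sum.cong) (force simp: U_cell_V field_simps)+
  also have "2 * V i l = of_bool (i = l) + (\<Sum>j<b. cell i j * GL j l)"
    using treatment_equation[of i l] assms by (simp add: rep_def)
  finally show ?thesis by (simp add: sum.distrib)
qed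

lemma C_V_row_sum:
  assumes "i < u"
  shows "(\<Sum>m<u. C i m * V_row_sum m) = 1 - u * (\<Sum>j<b. cell i j / (b * (k - s j)))"
proof -
  have "(\<Sum>m<u. C i m * V_row_sum m) = (\<Sum>l<u. \<Sum>m<u. C i m * V m l)"
    by (simp add: V_row_sum_def sum_mult_swap)
  also have "\<dots> = (\<Sum>l<u. of_bool (i = l) - (\<Sum>j<b. cell i j / (b * (k - s j))))"
    using C_V[OF assms] by simp
  finally show ?thesis using assms by (simp add: sum_subtractf)
qed

lemma C_C_pinv:
  assumes "i < u" "l < u"
  shows "(\<Sum>m<u. C i m * C_pinv m l) = of_bool (i = l) - 1 / u"
proof -
  \<comment> \<open>\<open>e\<close> collects the terms constant in \<open>m\<close>; the zero row
    sums of \<open>C\<close> annihilate them.\<close>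
  define e where "e = (\<Sum>m<u. V_row_sum m) / (real u)\<^sup>2 - V_row_sum l / u"
  have "C i m * C_pinv m l = C i m * V m l - C i m * V_row_sum m / u + C i m * e" for m
    by (simp add: C_pinv_def e_def algebra_simps)
  then have "(\<Sum>m<u. C i m * C_pinv m l) = (\<Sum>m<u. C i m * V m l) - (\<Sum>m<u. C i m * V_row_sum m) / u
      + (\<Sum>m<u. C i m) * e"
    by (simp add: sum.distrib sum_subtractf sum_distrib_right sum_divide_distrib)
  then show ?thesis using assms u_pos by (simp add: C_V C_V_row_sum C_row_sum field_simps)
qed

lemma C_pinv_sym: "C_pinv i l = C_pinv l i"
  by (simp add: C_pinv_def V_sym[of i l])

lemma C_pinv_row_sum: "(\<Sum>l<u. C_pinv i l) = 0"
proof -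
  have "(\<Sum>l<u. C_pinv i l) = (\<Sum>l<u. V i l) - V_row_sum i - (\<Sum>l<u. V_row_sum l) / u
      + u * ((\<Sum>m<u. V_row_sum m) / (real u)\<^sup>2)"
    using u_pos by (simp add: C_pinv_def sum.distrib sum_subtractf sum_divide_distrib)
  then show ?thesis using u_pos by (simp add: V_row_sum_def power2_eq_square)
qed

lemma trace_C_pinv: "u * (\<Sum>i<u. C_pinv i i) = u * (\<Sum>i<u. V i i) - (\<Sum>i<u. \<Sum>l<u. V i l)"
proof -
  have "C_pinv i i = V i i - 2 / u * V_row_sum i + (\<Sum>m<u. V_row_sum m) / (real u)\<^sup>2" for i
    by (simp add: C_pinv_def)
  then have "(\<Sum>i<u. C_pinv i i) = (\<Sum>i<u. V i i) - 2 / u * (\<Sum>i<u. V_row_sum i)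
      + u * ((\<Sum>m<u. V_row_sum m) / (real u)\<^sup>2)"
    by (simp only: sum.distrib sum_subtractf sum_distrib_left) simp
  then show ?thesis using u_pos by (simp add: V_row_sum_def field_simps power2_eq_square)
qed

section \<open>Traces and total sums of \<open>V\<close>\<close>

lemma trace_C_dual_G: "(\<Sum>j<b. \<Sum>l<b. C_dual j l * G l j) = real b - 1"
  using b_pos by (simp add: C_dual_G) (simp add: field_simps)

text \<open>The trace of \<open>V\<close> on \<open>U\<close> involves
  \<open>tr (N\<^sup>T N G)\<close>. Splitting \<open>C_dual\<close> by \<open>C_dual_eq\<close>
  inside \<open>tr (C_dual G) = b - 1\<close> expresses that trace through the diagonal of
  \<open>G\<close>.\<close>

lemma trace_V_U: "(\<Sum>i<u. V i i) = 1 / 2 * (u + (\<Sum>j<b. (k - s j) * G j j) - (real b - 1))"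
proof -
  have "(\<Sum>j<b. \<Sum>l<b. C_dual j l * G l j) = (\<Sum>j<b. (\<Sum>l<b. of_bool (j = l) * ((k - s j) * G l j))
      - (\<Sum>l<b. (1 / 2 * (\<Sum>t<u. cell t j * cell t l)) * G l j))"
    by (simp add: C_dual_eq left_diff_distrib sum_subtractf mult.assoc)
  also have "\<dots> = (\<Sum>j<b. (k - s j) * G j j) - (\<Sum>j<b. \<Sum>l<b. \<Sum>t<u. 1 / 2 * (cell t j * cell t l * G l j))"
    by (simp add: sum_subtractf sum_distrib_left sum_distrib_right mult.assoc)
  finally have 1: "(\<Sum>j<b. \<Sum>l<b. \<Sum>t<u. 1 / 2 * (cell t j * cell t l * G l j))
      = (\<Sum>j<b. (k - s j) * G j j) - (real b - 1)"
    by (simp add: trace_C_dual_G)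
  have "(\<Sum>i<u. V i i) = (\<Sum>i<u. 1 / 2 + (\<Sum>j<b. \<Sum>l<b. 1 / 4 * (cell i j * cell i l * G l j)))"
    by (intro sum.cong refl)
      (auto simp: V_def GL_def rep_def U_L sum_distrib_left G_sym mult_ac intro!: sum.cong)
  also have "\<dots> = u / 2 + (\<Sum>i<u. \<Sum>j<b. \<Sum>l<b. 1 / 4 * (cell i j * cell i l * G l j))"
    by (simp add: sum.distrib)
  also have "(\<Sum>i<u. \<Sum>j<b. \<Sum>l<b. 1 / 4 * (cell i j * cell i l * G l j))
      = (\<Sum>j<b. \<Sum>l<b. \<Sum>i<u. 1 / 2 * (1 / 2 * (cell i j * cell i l * G l j)))"
    by (rule trans[OF sum.swap], rule sum.cong[OF refl], rule trans[OF sum.swap]) simp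
  also have "\<dots> = 1 / 2 * ((\<Sum>j<b. (k - s j) * G j j) - (real b - 1))"
    unfolding 1[symmetric] sum_distrib_left ..
  finally show ?thesis by (simp add: field_simps)
qed

text \<open>A treatment of \<open>W\<close> in block \<open>j\<close> has
  \<open>V i i = 1 + G j j\<close>, and block \<open>j\<close> holds \<open>s j\<close> such
  treatments.\<close>

lemma trace_V_W: "(\<Sum>i=u..<v. V i i) = w + (\<Sum>j<b. s j * G j j)"
proof -
  have "V i i = 1 + (\<Sum>j<b. cell i j * G j j)" if i: "i \<in> {u..<v}" for i
  proof -
    have "(\<Sum>j<b. L i j * GL j i) = (\<Sum>j<b. \<Sum>l<b. (cell i j * cell i l) * G j l)"
      using i by (simp add: GL_def W_L sum_distrib_left mult_ac)
    also have "\<dots> = (\<Sum>j<b. \<Sum>l<b. of_bool (j = l) * (cell i j * G j l))"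
      using i by (simp add: W_cell_mult mult.assoc)
    also have "\<dots> = (\<Sum>j<b. cell i j * G j j)" by simp
    finally show ?thesis using i by (simp add: V_def rep_def)
  qed
  then have "(\<Sum>i=u..<v. V i i) = w + (\<Sum>i=u..<v. \<Sum>j<b. cell i j * G j j)"
    by (simp add: sum.distrib)
  also have "(\<Sum>i=u..<v. \<Sum>j<b. cell i j * G j j) = (\<Sum>j<b. (\<Sum>i=u..<v. cell i j) * G j j)"
    by (subst sum.swap) (simp add: sum_distrib_right)
  finally show ?thesis by (simp add: W_cell_sum)
qed

text \<open>The column sums of \<open>L\<close> are \<open>(k - s j) / 2\<close> over
  \<open>U\<close> and \<open>(k + s j) / 2\<close> over all treatments. These are the cases
  \<open>e = - 1 / 2\<close> and \<open>e = 1 / 2\<close>; only the square of \<open>e\<close>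
  enters, so both totals carry the same quadratic form in \<open>s\<close>.\<close>

lemma total_V:
  assumes T: "T \<subseteq> {..<v}" and c: "\<And>j. j < b \<Longrightarrow> (\<Sum>t\<in>T. L t j) = k / 2 + e * s j"
  shows "(\<Sum>i\<in>T. \<Sum>t\<in>T. V i t) = (\<Sum>i\<in>T. 1 / rep i) + e\<^sup>2 * (\<Sum>j<b. \<Sum>l<b. s j * G j l * s l)"
proof -
  have fin: "finite T" using T finite_subset by blast
  \<comment> \<open>The constant part \<open>k / 2\<close> of the column sums is annihilated by \<open>G\<close>.\<close>
  have G1: "(\<Sum>l<b. G j l * (k / 2 + e * s l)) = e * (\<Sum>l<b. G j l * s l)" if "j < b" for j
  proof -
    have "(\<Sum>l<b. G j l * (k / 2 + e * s l)) = (\<Sum>l<b. G j l) * (k / 2) + e * (\<Sum>l<b. G j l * s l)"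
      by (simp add: distrib_left sum.distrib sum_distrib_left sum_distrib_right mult.left_commute)
    then show ?thesis by (simp add: G_row_sum[OF that])
  qed
  have G2: "(\<Sum>j<b. (k / 2) * (\<Sum>l<b. G j l * s l)) = 0"
  proof -
    have "(\<Sum>j<b. \<Sum>l<b. G j l * s l) = (\<Sum>l<b. \<Sum>j<b. G l j * s l)"
      by (subst sum.swap) (intro sum.cong refl, simp add: G_sym)
    also have "\<dots> = 0" by (simp add: G_row_sum flip: sum_distrib_right)
    finally show ?thesis unfolding sum_distrib_left[symmetric] by simp
  qed
  have "(\<Sum>i\<in>T. \<Sum>t\<in>T. V i t)
      = (\<Sum>i\<in>T. (\<Sum>t\<in>T. of_bool (i = t) / rep i) + (\<Sum>t\<in>T. \<Sum>j<b. L i j * GL j t))"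
    by (simp add: V_def sum.distrib)
  also have "\<dots> = (\<Sum>i\<in>T. 1 / rep i) + (\<Sum>i\<in>T. \<Sum>t\<in>T. \<Sum>j<b. L i j * GL j t)"
    using fin by (simp add: sum.distrib flip: sum_divide_distrib)
  also have "(\<Sum>i\<in>T. \<Sum>t\<in>T. \<Sum>j<b. L i j * GL j t)
      = (\<Sum>i\<in>T. \<Sum>j<b. \<Sum>t\<in>T. L i j * GL j t)"
    by (rule sum.cong[OF refl]) (rule sum.swap)
  also have "\<dots> = (\<Sum>j<b. \<Sum>i\<in>T. \<Sum>t\<in>T. L i j * GL j t)"
    by (rule sum.swap)
  also have "\<dots> = (\<Sum>j<b. (\<Sum>i\<in>T. L i j) * (\<Sum>t\<in>T. GL j t))"
    by (simp only: sum_product)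
  also have "\<dots> = (\<Sum>j<b. (k / 2 + e * s j) * (\<Sum>l<b. G j l * (k / 2 + e * s l)))"
  proof (rule sum.cong[OF refl])
    fix j assume j: "j \<in> {..<b}"
    have "(\<Sum>t\<in>T. GL j t) = (\<Sum>l<b. G j l * (\<Sum>t\<in>T. L t l))"
      unfolding GL_def sum_distrib_left by (rule sum.swap)
    then show "(\<Sum>i\<in>T. L i j) * (\<Sum>t\<in>T. GL j t)
        = (k / 2 + e * s j) * (\<Sum>l<b. G j l * (k / 2 + e * s l))"
      using j by (simp add: c)
  qed
  also have "\<dots> = (\<Sum>j<b. (k / 2 + e * s j) * (e * (\<Sum>l<b. G j l * s l)))"
    by (simp add: G1)
  also have "\<dots> = e * (\<Sum>j<b. (k / 2) * (\<Sum>l<b. G j l * s l)) + e\<^sup>2 * (\<Sum>j<b. \<Sum>l<b. s j * G j l * s l)"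
    by (simp add: algebra_simps sum.distrib sum_distrib_left power2_eq_square)
  finally show ?thesis unfolding G2 by simp
qed

end

section \<open>Best linear unbiased estimators\<close>

lemma integrable_mult_of_squares:
  fixes f g :: "'a \<Rightarrow> real"
  assumes [measurable]: "f \<in> borel_measurable M" "g \<in> borel_measurable M"
    and "integrable M (\<lambda>x. (f x)\<^sup>2)" "integrable M (\<lambda>x. (g x)\<^sup>2)"
  shows "integrable M (\<lambda>x. f x * g x)"
proof (rule Bochner_Integration.integrable_bound)
  show "integrable M (\<lambda>x. (f x)\<^sup>2 + (g x)\<^sup>2)" using assms by simp
  show "AE x in M. norm (f x * g x) \<le> norm ((f x)\<^sup>2 + (g x)\<^sup>2)"
  proof (rule AE_I2)
    fix x
    have "0 \<le> (\<bar>f x\<bar> - \<bar>g x\<bar>)\<^sup>2" by simp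
    then have "2 * (\<bar>f x\<bar> * \<bar>g x\<bar>) \<le> (f x)\<^sup>2 + (g x)\<^sup>2"
      by (simp add: power2_diff)
    moreover have "0 \<le> \<bar>f x\<bar> * \<bar>g x\<bar>" by simp
    ultimately show "norm (f x * g x) \<le> norm ((f x)\<^sup>2 + (g x)\<^sup>2)"
      unfolding real_norm_def abs_mult by linarith
  qed
qed measurable

text \<open>Centring the variables first turns the variance into a double sum of covariances, of
  which only the diagonal survives. Square integrability makes the cross products integrable, so the
  integral may be taken termwise.\<close>

lemma (in prob_space) variance_linear_combination:
  fixes X :: "'i \<Rightarrow> 'a \<Rightarrow> real"
  assumes "finite I"
    and meas: "\<And>i. i \<in> I \<Longrightarrow> X i \<in> borel_measurable M"
    and sq: "\<And>i. i \<in> I \<Longrightarrow> integrable M (\<lambda>x. (X i x)\<^sup>2)"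
    and cov: "\<And>i j. i \<in> I \<Longrightarrow> j \<in> I \<Longrightarrow>
      expectation (\<lambda>x. (X i x - expectation (X i)) * (X j x - expectation (X j)))
        = (if i = j then \<sigma>\<^sup>2 else 0)"
  shows "expectation (\<lambda>x. \<Sum>i\<in>I. c i * X i x) = (\<Sum>i\<in>I. c i * expectation (X i))"
    and "variance (\<lambda>x. \<Sum>i\<in>I. c i * X i x) = \<sigma>\<^sup>2 * (\<Sum>i\<in>I. (c i)\<^sup>2)"
proof -
  have int: "integrable M (X i)" if "i \<in> I" for i
    using square_integrable_imp_integrable[OF meas[OF that] sq[OF that]] .
  show E: "expectation (\<lambda>x. \<Sum>i\<in>I. c i * X i x) = (\<Sum>i\<in>I. c i * expectation (X i))"
    by (simp add: int)
  define Z where "Z i x = X i x - expectation (X i)" for i x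
  have "Z i \<in> borel_measurable M" if "i \<in> I" for i
    using meas[OF that] unfolding Z_def by measurable
  moreover have "integrable M (\<lambda>x. (Z i x)\<^sup>2)" if "i \<in> I" for i
    using int[OF that] sq[OF that] by (simp add: Z_def power2_diff)
  ultimately have Zint: "integrable M (\<lambda>x. Z i x * Z j x)" if "i \<in> I" "j \<in> I" for i j
    using that by (intro integrable_mult_of_squares) auto
  have "variance (\<lambda>x. \<Sum>i\<in>I. c i * X i x) = expectation (\<lambda>x. (\<Sum>i\<in>I. c i * Z i x)\<^sup>2)"
    unfolding E by (simp add: Z_def right_diff_distrib sum_subtractf)
  also have "\<dots> = expectation (\<lambda>x. \<Sum>i\<in>I. \<Sum>j\<in>I. c i * c j * (Z i x * Z j x))"
    by (simp add: power2_eq_square sum_product mult_ac)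
  also have "\<dots> = (\<Sum>i\<in>I. \<Sum>j\<in>I. c i * c j * expectation (\<lambda>x. Z i x * Z j x))"
    by (subst Bochner_Integration.integral_sum, simp add: Zint, intro sum.cong refl,
        subst Bochner_Integration.integral_sum) (simp_all add: Zint)
  also have "\<dots> = (\<Sum>i\<in>I. \<Sum>j\<in>I. c i * c j * (if i = j then \<sigma>\<^sup>2 else 0))"
    using cov by (simp add: Z_def)
  also have "\<dots> = (\<Sum>i\<in>I. (c i)\<^sup>2 * \<sigma>\<^sup>2)"
    using \<open>finite I\<close> by (simp add: if_distrib power2_eq_square cong: if_cong)
  finally show "variance (\<lambda>x. \<Sum>i\<in>I. c i * X i x) = \<sigma>\<^sup>2 * (\<Sum>i\<in>I. (c i)\<^sup>2)"
    by (simp add: sum_distrib_left mult.commute)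
qed

locale linear_block_model = 
  fixes b k :: nat and d :: "plot \<Rightarrow> nat" and \<sigma> :: real
    and P :: "'o model" and Y :: "plot \<Rightarrow> 'o \<Rightarrow> real"
  assumes model: "block_model b k d \<sigma> P Y"
begin

definition est :: "(plot \<Rightarrow> real) \<Rightarrow> 'o \<Rightarrow> real" where
  "est c = (\<lambda>\<omega>. \<Sum>p\<in>plots b k. c p * Y p \<omega>)"

lemma expectation_est:
    "prob_space.expectation (P \<tau> \<beta>) (est c) = (\<Sum>p\<in>plots b k. c p * (\<tau> (d p) + \<beta> (fst p)))"
  and variance_est:
    "prob_space.variance (P \<tau> \<beta>) (est c) = \<sigma>\<^sup>2 * (\<Sum>p\<in>plots b k. (c p)\<^sup>2)"
proof -
  interpret prob_space "P \<tau> \<beta>" using model by (simp add: block_model_def)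
  have fin: "finite (plots b k)" by (simp add: plots_def)
  have Y: "Y p \<in> borel_measurable (P \<tau> \<beta>)" "integrable (P \<tau> \<beta>) (\<lambda>\<omega>. (Y p \<omega>)\<^sup>2)"
    "expectation (Y p) = \<tau> (d p) + \<beta> (fst p)"
    if "p \<in> plots b k" for p
    using model that by (simp_all add: block_model_def)
  have cov: "expectation (\<lambda>\<omega>. (Y p \<omega> - expectation (Y p)) * (Y q \<omega> - expectation (Y q)))
      = (if p = q then \<sigma>\<^sup>2 else 0)"
    if "p \<in> plots b k" "q \<in> plots b k" for p q
    using model that unfolding block_model_def by blast
  note lin = variance_linear_combination[OF fin Y(1,2) cov]
  show "expectation (est c) = (\<Sum>p\<in>plots b k. c p * (\<tau> (d p) + \<beta> (fst p)))"
    unfolding est_def by (simp add: lin(1) Y(3))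
  show "variance (est c) = \<sigma>\<^sup>2 * (\<Sum>p\<in>plots b k. (c p)\<^sup>2)"
    unfolding est_def by (rule lin(2))
qed

text \<open>Reduces unbiasedness to a condition on coefficients. Together with
  \<open>variance_est\<close>, finding a BLUE becomes a minimum-norm problem.\<close>

lemma lue_iff:
  "lue b k P Y i j T \<longleftrightarrow>
    (\<exists>c. T = est c \<and> (\<forall>\<tau> \<beta>. (\<Sum>p\<in>plots b k. c p * (\<tau> (d p) + \<beta> (fst p))) = \<tau> i - \<tau> j))"
  unfolding lue_def linear_estimator_def est_def[symmetric]
  by (auto simp: expectation_est)

end

context block_design_dual_inverse
begin

lemma blue_est_coeff:
  assumes "linear_block_model b k d \<sigma> P Y" and ij: "i < v" "j < v"
  shows "blue b k P Y i j (linear_block_model.est b k Y (coeff i j))"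
proof -
  interpret linear_block_model b k d \<sigma> P Y by fact
  show ?thesis
    unfolding blue_def lue_iff
    using coeff_unbiased[OF ij] coeff_minimal[OF ij]
    by (auto simp: variance_est coeff_norm[OF ij] intro!: mult_left_mono)
qed

text \<open>Two BLUEs of the same contrast bound each other's variance; only the variances are
  compared, not the estimators.\<close>

lemma variance_blue:
  assumes "linear_block_model b k d \<sigma> P Y" and ij: "i < v" "j < v"
    and T: "blue b k P Y i j T"
  shows "prob_space.variance (P \<tau> \<beta>) T = \<sigma>\<^sup>2 * pair_var i j"
proof -
  interpret linear_block_model b k d \<sigma> P Y by fact
  have "blue b k P Y i j (est (coeff i j))"
    by (rule blue_est_coeff[OF assms(1-3)])
  with T have "prob_space.variance (P \<tau> \<beta>) T = prob_space.variance (P \<tau> \<beta>) (est (coeff i j))"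
    unfolding blue_def by (meson order_antisym)
  then show ?thesis by (simp add: variance_est coeff_norm[OF ij])
qed

end

section \<open>The sum of the variances\<close>

context block_design_dual_inverse
begin

text \<open>The square of index pairs splits into two triangles with equal sums and a diagonal on
  which \<open>pair_var\<close> is zero, so the sum over all ordered pairs is halved.\<close>

lemma sum_pair_var:
  "(\<Sum>(i, j) | i < j \<and> j < v. pair_var i j) = v * (\<Sum>i<v. V i i) - (\<Sum>i<v. \<Sum>j<v. V i j)"
proof -
  have eq: "pair_var i j = V i i + V j j - 2 * V i j" for i j
    by (simp add: pair_var_def V_sym[of j i])
  let ?f = "\<lambda>(i, j). pair_var i j" and ?lt = "{(i, j). i < j \<and> j < v}"
    and ?gt = "{(i, j). j < i \<and> i < v}" and ?eq = "(\<lambda>i. (i, i)) ` {..<v}"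
  have fin: "finite ?lt" "finite ?gt"
    by (rule finite_subset[of _ "{..<v} \<times> {..<v}"]; auto)+
  have "sum ?f ?gt = sum ?f ?lt"
    by (rule sum.reindex_bij_witness[of _ prod.swap prod.swap]) (auto simp: eq V_sym)
  moreover have "sum ?f ?eq = 0"
    by (rule sum.neutral) (auto simp: eq)
  moreover have "sum ?f ((?lt \<union> ?gt) \<union> ?eq) = sum ?f (?lt \<union> ?gt) + sum ?f ?eq"
    using fin by (intro sum.union_disjoint) auto
  moreover have "sum ?f (?lt \<union> ?gt) = sum ?f ?lt + sum ?f ?gt"
    using fin by (intro sum.union_disjoint) auto
  moreover have "(?lt \<union> ?gt) \<union> ?eq = {..<v} \<times> {..<v}" by (auto simp: image_iff)
  ultimately have "(\<Sum>(i, j)\<in>{..<v} \<times> {..<v}. pair_var i j) = 2 * (\<Sum>(i, j)\<in>?lt. pair_var i j)"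
    by simp
  moreover have "(\<Sum>(i, j)\<in>{..<v} \<times> {..<v}. pair_var i j)
      = 2 * (v * (\<Sum>i<v. V i i) - (\<Sum>i<v. \<Sum>j<v. V i j))"
    by (simp add: eq sum.distrib sum_subtractf flip: sum.cartesian_product sum_distrib_left)
  ultimately show ?thesis by simp
qed

lemma sum_pair_var_eq:
  "(\<Sum>(i, j) | i < j \<and> j < v. pair_var i j)
    = 1 / 2 * real w * (3 * real u + 2 * real w - real b - 1) + real u * (\<Sum>i<u. C_pinv i i)
      + 1 / 2 * real k * (real w * (\<Sum>j<b. G j j) + real b * (\<Sum>j<b. G j j * s j))"
proof -
  define q where "q = (\<Sum>j<b. \<Sum>l<b. s j * G j l * s l)"
  define g where "g = (\<Sum>j<b. G j j)"
  define h where "h = (\<Sum>j<b. s j * G j j)"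
  define tU where "tU = (\<Sum>i<u. V i i)"
  have "(\<Sum>t<u. L t j) = k / 2 + (- 1 / 2) * s j" if "j < b" for j
    using U_cell_sum[OF that] by (simp add: U_L field_simps flip: sum_divide_distrib)
  then have "(\<Sum>i<u. \<Sum>t<u. V i t) = (\<Sum>i<u. 1 / rep i) + (- 1 / 2)\<^sup>2 * q"
    unfolding q_def by (intro total_V) auto
  then have SU: "(\<Sum>i<u. \<Sum>t<u. V i t) = u / 2 + q / 4"
    by (simp add: rep_def power2_eq_square)
  have "(\<Sum>t<v. L t j) = k / 2 + 1 / 2 * s j" if "j < b" for j
    using U_cell_sum[OF that] W_cell_sum[OF that]
    by (simp add: split_treatments U_L W_L field_simps flip: sum_divide_distrib)
  then have "(\<Sum>i<v. \<Sum>t<v. V i t) = (\<Sum>i<v. 1 / rep i) + (1 / 2)\<^sup>2 * q"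
    unfolding q_def by (intro total_V) auto
  then have SV: "(\<Sum>i<v. \<Sum>t<v. V i t) = u / 2 + w + q / 4"
    by (simp add: split_treatments rep_def power2_eq_square)
  have tU: "tU = 1 / 2 * (u + (k * g - h) - (real b - 1))"
    unfolding tU_def trace_V_U g_def h_def
    by (simp add: left_diff_distrib sum_subtractf sum_distrib_left)
  have tV: "(\<Sum>i<v. V i i) = tU + (w + h)"
    unfolding tU_def h_def trace_V_W[symmetric] by (rule split_treatments)
  have bk: "real b * real k = 2 * u + w"
    using plots_count by (metis of_nat_add of_nat_mult of_nat_numeral)
  \<comment> \<open>\<open>trace_V_U\<close> solved for \<open>k * g\<close>, so that
    \<open>g\<close> is eliminated in favour of \<open>tU\<close> and \<open>h\<close>.\<close>
  have kg: "real k * g = 2 * tU - u + h + (real b - 1)"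
    by (simp add: tU field_simps)
  have "1 / 2 * real k * (real w * g + real b * h) = 1 / 2 * (w * (k * g) + (real b * real k) * h)"
    by (simp add: algebra_simps)
  also have "\<dots> = 1 / 2 * (w * (2 * tU - u + h + (real b - 1)) + (2 * u + w) * h)"
    unfolding bk kg ..
  finally have 1: "1 / 2 * real k * (real w * g + real b * h)
    = 1 / 2 * (w * (2 * tU - u + h + (real b - 1)) + (2 * u + w) * h)" .
  have 2: "(\<Sum>j<b. G j j * s j) = h" by (simp add: h_def mult.commute)
  \<comment> \<open>Both sides now carry \<open>- q / 4\<close>, on the left from the total of
    \<open>V\<close> and on the right from the trace of \<open>C_pinv\<close>. What remains is a
    polynomial identity.\<close>
  show ?thesis
    unfolding sum_pair_var trace_C_pinv tV SU SV 2 g_def[symmetric] tU_def[symmetric] 1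
    by (simp add: field_simps)
qed

end

section \<open>Matrices of the statement as coefficient functions\<close>

context block_design
begin

lemma S_mat_index: "S_mat u b k d = mat b b (\<lambda>(i, j). if i = j then s j else 0)"
  unfolding S_mat_def mat_diag_def s_def by (rule cong_mat) auto

lemma N_mat_index: "N_mat u b k d = mat u b (\<lambda>(i, j). cell i j)"
  by (simp add: N_mat_def cell_def)

lemma transpose_N_mat_index: "transpose_mat (N_mat u b k d) = mat b u (\<lambda>(i, j). cell j i)"
  by (rule eq_matI) (auto simp: N_mat_index)

lemma C_dual_mat_eq: "C_dual_mat u b k d = mat b b (\<lambda>(i, j). C_dual i j)"
  unfolding C_dual_mat_def transpose_N_mat_index unfolding N_mat_index S_mat_index mat_mult_mat
  by (rule eq_matI) (auto simp: C_dual_eq)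

end

context block_design_dual_inverse
begin

lemma C_mat_eq: "C_mat u b k d = mat u u (\<lambda>(i, j). C i j)"
proof -
  \<comment> \<open>The matrix is diagonal, and \<open>W_plots_less\<close> keeps its entries
    \<open>k - s j\<close> away from zero.\<close>
  have "the (mat_inverse (real k \<cdot>\<^sub>m 1\<^sub>m b - S_mat u b k d)) = mat_diag b (\<lambda>j. 1 / (k - s j))"
  proof (rule the_mat_inverse_eq)
    have diag: "real k \<cdot>\<^sub>m 1\<^sub>m b - S_mat u b k d = mat_diag b (\<lambda>j. k - s j)"
      unfolding S_mat_index mat_diag_def by (rule eq_matI) auto
    show "(real k \<cdot>\<^sub>m 1\<^sub>m b - S_mat u b k d) * mat_diag b (\<lambda>j. 1 / (k - s j)) = 1\<^sub>m b"
      unfolding diag mat_diag_mult_left[OF mat_diag_dim] using W_plots_less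
      by (intro eq_matI) (force simp: mat_diag_def)+
  qed (auto simp: S_mat_def intro!: minus_carrier_mat)
  then show ?thesis
    unfolding C_mat_def transpose_N_mat_index
    unfolding N_mat_index
    by (simp add: mat_diag_mult_right[OF mat_carrier] mat_mult_mat)
      (rule eq_matI, auto simp: C_def mat_mult_mat intro!: sum.cong)
qed

lemma mp_inverse_C_mat: "mp_inverse (C_mat u b k d) = mat u u (\<lambda>(i, j). C_pinv i j)"
  unfolding C_mat_eq
  using C_sym C_pinv_sym C_row_sum C_pinv_row_sum C_C_pinv by (rule mp_inverse_centred)

lemma mp_inverse_C_dual_mat: "mp_inverse (C_dual_mat u b k d) = mat b b (\<lambda>(i, j). G i j)"
  unfolding C_dual_mat_eq
  using C_dual_sym G_sym C_dual_row_sum G_row_sum C_dual_G by (rule mp_inverse_centred)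

lemma A_value_eq: "A_value u w b k d = (\<Sum>(i, j) | i < j \<and> j < v. pair_var i j)"
proof -
  have "mat_trace (mp_inverse (C_dual_mat u b k d) * S_mat u b k d) = (\<Sum>j<b. G j j * s j)"
    unfolding mp_inverse_C_dual_mat S_mat_index mat_mult_mat
    by (simp add: mat_trace_def if_distrib cong: if_cong)
  then show ?thesis
    unfolding A_value_def sum_pair_var_eq mp_inverse_C_mat mp_inverse_C_dual_mat
    by (simp add: mat_trace_def)
qed

end

theorem theorem1:
  fixes u w b k v :: nat
    and d :: "plot \<Rightarrow> nat"
    and \<sigma> :: real
    and P :: "'o model"
    and Y :: "plot \<Rightarrow> 'o \<Rightarrow> real"
  assumes "u \<ge> 1" and "b \<ge> 1" and "k \<ge> 1"
    and "b * k = 2 * u + w"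
    and "v = u + w"
    and "full_design u w b k d"
    and "block_model b k d \<sigma> P Y"
    and "connected_design v b k P Y"
  shows "(\<forall>i j. i < j \<and> j < v \<longrightarrow> (\<exists>T. blue b k P Y i j T)) \<and>
    (\<forall>T. (\<forall>i j. i < j \<and> j < v \<longrightarrow> blue b k P Y i j (T i j)) \<longrightarrow>
      (\<forall>\<tau> \<beta>. (\<Sum>(i, j) \<in> {(i, j). i < j \<and> j < v}. prob_space.variance (P \<tau> \<beta>) (T i j))
        = \<sigma>\<^sup>2 * A_value u w b k d))"
proof -
  have block_model: "linear_block_model b k d \<sigma> P Y"
    using assms(7) by (rule linear_block_model.intro)
  interpret linear_block_model b k d \<sigma> P Y by (rule block_model)
  \<comment> \<open>The locale states connectedness through coefficients, free of probability;
    \<open>lue_iff\<close> supplies that form.\<close>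
  interpret D: connected_block_design u w b k d
  proof
    fix i j assume "i < u + w" "j < u + w"
    then obtain T where "lue b k P Y i j T"
      using assms(5,8) unfolding connected_design_def by blast
    then show "\<exists>c :: plot \<Rightarrow> real. \<forall>\<tau> \<beta> :: nat \<Rightarrow> real.
        (\<Sum>p\<in>plots b k. c p * (\<tau> (d p) + \<beta> (fst p))) = \<tau> i - \<tau> j"
      unfolding lue_iff by auto
  qed (use assms in auto)
  obtain G where "\<And>i j. i < b \<Longrightarrow> j < b \<Longrightarrow> G i j = G j i"
    and "\<And>i. i < b \<Longrightarrow> (\<Sum>j<b. G i j) = 0"
    and "\<And>i l. i < b \<Longrightarrow> l < b \<Longrightarrow> (\<Sum>j<b. D.C_dual i j * G j l) = of_bool (i = l) - 1 / b"
    using centred_inverse_exists[OF D.b_pos D.C_dual_sym D.C_dual_row_sum D.C_dual_kernel] by blast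
  then interpret D: block_design_dual_inverse u w b k d G
    by unfold_locales
  note blue_exists = D.blue_est_coeff[OF block_model, folded assms(5)]
    and blue_var = D.variance_blue[OF block_model, folded assms(5)]
  show ?thesis
  proof (intro conjI allI impI)
    fix i j assume "i < j \<and> j < v"
    then show "\<exists>T. blue b k P Y i j T" using blue_exists[of i j] by auto
  next
    fix T \<tau> \<beta> assume T: "\<forall>i j. i < j \<and> j < v \<longrightarrow> blue b k P Y i j (T i j)"
    have "(\<Sum>(i, j) \<in> {(i, j). i < j \<and> j < v}. prob_space.variance (P \<tau> \<beta>) (T i j))
        = (\<Sum>(i, j) \<in> {(i, j). i < j \<and> j < v}. \<sigma>\<^sup>2 * D.pair_var i j)"
      using T by (intro sum.cong refl) (auto simp: blue_var)
    also have "\<dots> = \<sigma>\<^sup>2 * A_value u w b k d"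
      unfolding D.A_value_eq assms(5) by (simp add: sum_distrib_left case_prod_unfold)
    finally show "(\<Sum>(i, j) \<in> {(i, j). i < j \<and> j < v}. prob_space.variance (P \<tau> \<beta>) (T i j))
        = \<sigma>\<^sup>2 * A_value u w b k d" .
  qed
qed

end
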